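(* Let $n$, $2s$, $\delta$ and $\ell$ be positive integers with $n \geq 2s+1\geq 5$ and $\ell\geq 2$ (so $s$ is an integer or a half-integer). Let $G$ be a graph of order $n$ with fractional matching number $\nu^{*}(G)=s$ and minimum degree $\delta(G)=\delta$. If $2s$ is even, then $$N(K_{\ell},G)\leq \max\left\{g_{\ell}(n,s,\delta),\,g_{\ell}(n,s,s)\right\}.$$ If $2s$ is odd, then $$N(K_{\ell},G)\leq \max\left\{g_{\ell}(n,s,\delta),\,g_{\ell}\left(n,s,s-\tfrac{3}{2}\right)\right\}.$$
   Context: All graphs are finite and simple. A fractional matching of a graph $G$ is a function $f:E(G)\to[0,1]$ such that $\sum_{e\ni x}f(e)\le 1$ for every vertex $x$; the fractional matching number $\nu^{*}(G)$ is the maximum of $\sum_{e\in E(G)}f(e)$ over all fractional matchings $f$. For graphs $H,G$, $N(H,G)$ denotes the number of (not necessarily induced) subgraphs of $G$ isomorphic to $H$. $K_m$ is the complete graph on $m$ vertices, $\overline{K_m}$ the edgeless graph on $m$ vertices, $H+F$ the disjoint union, and $H\vee F$ the join (disjoint union plus all edges between $V(H)$ and $V(F)$). For an integer $t$ with $\delta\le t\le s$, $G(n,s,t)$ denotes the graph obtained from $K_{t}\vee\left(K_{2s-2t}+\overline{K_{n+t-2s}}\right)$ by deleting $t-\delta$ edges incident to one common vertex $u$ of $\overline{K_{n+t-2s}}$ (so $u$ has degree $\delta$), and $g_{\ell}(n,s,t)=N(K_\ell,G(n,s,t))$. *)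

theory Defs
  imports Complex_Main
begin

record 'a sgraph =
  verts :: "'a set"
  edges :: "'a set set"

definition simple_graph :: "'a sgraph \<Rightarrow> bool" where
  "simple_graph G \<longleftrightarrow> finite (verts G) \<and> (\<forall>e \<in> edges G. e \<subseteq> verts G \<and> card e = 2)"

definition vertex_degree :: "'a sgraph \<Rightarrow> 'a \<Rightarrow> nat" where
  "vertex_degree G x = card {e \<in> edges G. x \<in> e}"

definition min_degree :: "'a sgraph \<Rightarrow> nat" where
  "min_degree G = Min (vertex_degree G ` verts G)"

definition fractional_matching :: "'a sgraph \<Rightarrow> ('a set \<Rightarrow> real) \<Rightarrow> bool" where
  "fractional_matching G f \<longleftrightarrow>
     (\<forall>e \<in> edges G. 0 \<le> f e \<and> f e \<le> 1) \<and>
     (\<forall>x \<in> verts G. (\<Sum>e \<in> {e \<in> edges G. x \<in> e}. f e) \<le> 1)"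

definition fractional_matching_number :: "'a sgraph \<Rightarrow> real" where
  "fractional_matching_number G =
     (GREATEST w. \<exists>f. fractional_matching G f \<and> w = (\<Sum>e \<in> edges G. f e))"

definition subgraph :: "'a sgraph \<Rightarrow> 'a sgraph \<Rightarrow> bool" where
  "subgraph S G \<longleftrightarrow> simple_graph S \<and> verts S \<subseteq> verts G \<and> edges S \<subseteq> edges G"

definition graph_isomorphic :: "'a sgraph \<Rightarrow> 'b sgraph \<Rightarrow> bool" where
  "graph_isomorphic H S \<longleftrightarrow>
     (\<exists>\<phi>. bij_betw \<phi> (verts H) (verts S) \<and>
          (\<forall>x \<in> verts H. \<forall>y \<in> verts H. {x, y} \<in> edges H \<longleftrightarrow> {\<phi> x, \<phi> y} \<in> edges S))"

definition subgraph_count :: "'a sgraph \<Rightarrow> 'b sgraph \<Rightarrow> nat" where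
  "subgraph_count H G = card {S. subgraph S G \<and> graph_isomorphic H S}"

definition complete_graph :: "nat \<Rightarrow> nat sgraph" where
  "complete_graph m = \<lparr>verts = {..<m}, edges = {e. e \<subseteq> {..<m} \<and> card e = 2}\<rparr>"

definition edgeless_graph :: "nat \<Rightarrow> nat sgraph" where
  "edgeless_graph m = \<lparr>verts = {..<m}, edges = {}\<rparr>"

definition graph_union :: "'a sgraph \<Rightarrow> 'b sgraph \<Rightarrow> ('a + 'b) sgraph" where
  "graph_union H F =
     \<lparr>verts = verts H <+> verts F,
      edges = (`) Inl ` edges H \<union> (`) Inr ` edges F\<rparr>"

definition graph_join :: "'a sgraph \<Rightarrow> 'b sgraph \<Rightarrow> ('a + 'b) sgraph" where
  "graph_join H F =
     \<lparr>verts = verts H <+> verts F,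
      edges = edges (graph_union H F) \<union> {{Inl x, Inr y} | x y. x \<in> verts H \<and> y \<in> verts F}\<rparr>"

definition delete_edges :: "'a sgraph \<Rightarrow> 'a set set \<Rightarrow> 'a sgraph" where
  "delete_edges G D = \<lparr>verts = verts G, edges = edges G - D\<rparr>"

text \<open>
  The number \<open>s\<close> is an integer or a half-integer, so all the arguments of \<open>nat \<lfloor>_\<rfloor>\<close>
  below are integers; they are nonnegative in the intended range \<open>\<delta> \<le> t \<le> s\<close>, \<open>2 s \<le> n + t\<close>.
  The vertex \<open>u\<close> is \<open>Inr (Inr 0)\<close>. Its neighbours before the deletion are the \<open>t\<close> vertices
  \<open>Inl i\<close> with \<open>i < t\<close>, and those with \<open>i < \<delta>\<close> are kept. Which \<open>t - \<delta>\<close> of the edges at \<open>u\<close>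
  are deleted does not matter up to isomorphism.
\<close>

definition extremal_graph ::
    "nat \<Rightarrow> nat \<Rightarrow> real \<Rightarrow> nat \<Rightarrow> (nat + (nat + nat)) sgraph" where
  "extremal_graph \<delta> n s t =
     delete_edges
       (graph_join (complete_graph t)
          (graph_union (complete_graph (nat \<lfloor>2 * s - 2 * real t\<rfloor>))
                       (edgeless_graph (nat \<lfloor>real n + real t - 2 * s\<rfloor>))))
       {{Inl i, Inr (Inr 0)} | i. \<delta> \<le> i \<and> i < t}"

definition extremal_clique_count :: "nat \<Rightarrow> nat \<Rightarrow> nat \<Rightarrow> real \<Rightarrow> nat \<Rightarrow> nat" where
  "extremal_clique_count \<delta> l n s t =
     subgraph_count (complete_graph l) (extremal_graph \<delta> n s t)"

end

theory Submission imports Defs begin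

text \<open>
  Hall's theorem in the bipartite double cover of \<open>G\<close> yields the fractional Tutte--Berge
  formula: there are a set \<open>T\<close> of \<open>t\<close> vertices and an independent set \<open>I\<close> of \<open>n + t - 2 s\<close>
  vertices whose neighbours all lie in \<open>T\<close>. Splitting the cliques according to whether they
  contain a vertex of minimum degree bounds their number by
  \<open>(2 s - t choose l) + (n - 2 s - 1 + t) (t choose l - 1) + (\<delta> choose l - 1)\<close>,
  which is the number of cliques of \<open>G(n, s, t)\<close>. This is convex in \<open>t\<close>, so an
  endpoint of the range of \<open>t\<close> is extremal. For odd \<open>2 s\<close> the value \<open>t = s - 1/2\<close> cannot
  occur, as \<open>T\<close> would then be a vertex cover with fewer than \<open>s\<close> vertices.
\<close>

section \<open>Hall's theorem with deficiency\<close>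

text \<open>If no pair can be removed from \<open>E\<close> without violating the hypothesis, then submodularity
  of \<open>S \<mapsto> card (E `` S)\<close> makes \<open>E\<close> single-valued, and each \<open>y \<in> E `` X\<close> selects one partner.\<close>

lemma deficiency_Hall:
  fixes E :: "('a \<times> 'b) set"
  assumes "finite X" "finite E" "E \<subseteq> X \<times> UNIV"
    and "\<And>S. S \<subseteq> X \<Longrightarrow> card S \<le> card (E `` S) + d"
  shows "\<exists>M \<subseteq> E. inj_on fst M \<and> inj_on snd M \<and> card X \<le> card M + d"
  using assms(2-4)
proof (induction E rule: finite_psubset_induct)
  case (psubset E)
  have finI [simp]: "finite (E' `` S)" if "E' \<subseteq> E" for E' S
    using finite_subset[OF that psubset.hyps] by (simp add: finite_Image)
  show ?case
  proof (cases "\<exists>p \<in> E. \<forall>S \<subseteq> X. card S \<le> card ((E - {p}) `` S) + d")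
    case True
    then obtain p where p: "p \<in> E" "\<forall>S \<subseteq> X. card S \<le> card ((E - {p}) `` S) + d"
      by blast
    then have "\<exists>M \<subseteq> E - {p}. inj_on fst M \<and> inj_on snd M \<and> card X \<le> card M + d"
      using psubset.prems(1) by (intro psubset.IH) auto
    then show ?thesis
      by blast
  next
    case False
    have single: "y = z" if xy: "(x, y) \<in> E" and xz: "(x, z) \<in> E" for x y z
    proof (rule ccontr)
      assume "y \<noteq> z"
      define E1 where "E1 = E - {(x, y)}"
      define E2 where "E2 = E - {(x, z)}"
      obtain S1 where S1: "S1 \<subseteq> X" "card S1 > card (E1 `` S1) + d"
        using False xy unfolding E1_def by (meson not_le)
      obtain S2 where S2: "S2 \<subseteq> X" "card S2 > card (E2 `` S2) + d"
        using False xz unfolding E2_def by (meson not_le)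
      have fin: "finite S1" "finite S2"
        using S1(1) S2(1) assms(1) finite_subset by blast+
      \<comment> \<open>\<open>S1\<close> violates the bound only after the deletion of
        \<open>(x, y)\<close>, so that deletion must change its image.\<close>
      have x1: "x \<in> S1"
      proof (rule ccontr)
        assume "x \<notin> S1"
        then have "E1 `` S1 = E `` S1"
          by (auto simp: E1_def)
        then show False
          using psubset.prems(2)[OF S1(1)] S1(2) by simp
      qed
      have x2: "x \<in> S2"
      proof (rule ccontr)
        assume "x \<notin> S2"
        then have "E2 `` S2 = E `` S2"
          by (auto simp: E2_def)
        then show False
          using psubset.prems(2)[OF S2(1)] S2(2) by simp
      qed
      \<comment> \<open>The point \<open>y\<close>, which may be lost from the image of
        \<open>S1\<close>, is regained through \<open>(x, y)\<close> in \<open>E2\<close>, and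
        \<open>z\<close> likewise through \<open>E1\<close>; this is where
        \<open>y \<noteq> z\<close> enters.\<close>
      have un: "E1 `` S1 \<union> E2 `` S2 = E `` (S1 \<union> S2)"
      proof -
        have "y \<in> E2 `` S2" "z \<in> E1 `` S1"
          using x1 x2 xy xz \<open>y \<noteq> z\<close> by (auto simp: E1_def E2_def)
        then show ?thesis
          by (fastforce simp: E1_def E2_def)
      qed
      \<comment> \<open>Once \<open>x\<close> is left out, neither deletion affects the
        image.\<close>
      have int: "E `` (S1 \<inter> S2 - {x}) \<subseteq> E1 `` S1 \<inter> E2 `` S2"
        by (auto simp: E1_def E2_def)
      have "E1 \<subseteq> E" "E2 \<subseteq> E"
        by (auto simp: E1_def E2_def)
      then have "card (E1 `` S1) + card (E2 `` S2)
          = card (E `` (S1 \<union> S2)) + card (E1 `` S1 \<inter> E2 `` S2)"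
        using card_Un_Int[of "E1 `` S1" "E2 `` S2"] un by simp
      moreover have "card (E `` (S1 \<inter> S2 - {x})) \<le> card (E1 `` S1 \<inter> E2 `` S2)"
        using int \<open>E1 \<subseteq> E\<close> by (intro card_mono) auto
      moreover have "card (S1 \<union> S2) \<le> card (E `` (S1 \<union> S2)) + d"
        using S1(1) S2(1) by (intro psubset.prems(2)) auto
      moreover have "card (S1 \<inter> S2 - {x}) \<le> card (E `` (S1 \<inter> S2 - {x})) + d"
        using S1(1) by (intro psubset.prems(2)) auto
      moreover have "card (S1 \<inter> S2 - {x}) + 1 = card (S1 \<inter> S2)"
        using x1 x2 fin card_Suc_Diff1[of "S1 \<inter> S2" x] by simp
      moreover have "card S1 + card S2 = card (S1 \<union> S2) + card (S1 \<inter> S2)"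
        by (rule card_Un_Int) (use fin in auto)
      \<comment> \<open>The two strict violations together gain 2, while leaving out
        \<open>x\<close> costs only 1.\<close>
      ultimately show False
        using S1(2) S2(2) by linarith
    qed
    define g where "g y = (SOME x. (x, y) \<in> E)" for y
    define M where "M = (\<lambda>y. (g y, y)) ` (E `` X)"
    have "(g y, y) \<in> E" if "y \<in> E `` X" for y
      using that unfolding g_def by (auto intro: someI)
    then have ME: "M \<subseteq> E"
      by (auto simp: M_def)
    have "inj_on fst M"
      using ME single by (fastforce simp: inj_on_def)
    moreover have "inj_on snd M"
      by (auto simp: M_def inj_on_def)
    moreover have "card M = card (E `` X)"
      unfolding M_def by (intro card_image) (auto simp: inj_on_def)
    ultimately show ?thesis
      using ME psubset.prems(2)[of X] by auto
  qed
qed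

section \<open>Fractional matchings\<close>

lemma simple_graph_finite_edges:
  assumes "simple_graph G"
  shows "finite (edges G)"
proof -
  have "edges G \<subseteq> Pow (verts G)" "finite (verts G)"
    using assms by (auto simp: simple_graph_def)
  then show ?thesis
    by (meson finite_Pow_iff finite_subset)
qed

text \<open>Weak linear programming duality, with \<open>c\<close> a fractional vertex cover: each
  edge weight is distributed over its ends according to \<open>c\<close>, and the double sum is
  exchanged.\<close>

lemma fractional_matching_le_cover:
  assumes "simple_graph G" "fractional_matching G f"
    and "\<And>x. x \<in> verts G \<Longrightarrow> 0 \<le> c x"
    and "\<And>e. e \<in> edges G \<Longrightarrow> 1 \<le> (\<Sum>x\<in>e. c x)"
  shows "(\<Sum>e\<in>edges G. f e) \<le> (\<Sum>x\<in>verts G. c x)"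
proof -
  have fin: "finite (verts G)" "finite (edges G)"
    using assms(1) simple_graph_finite_edges by (auto simp: simple_graph_def)
  have sub: "e = {x \<in> verts G. x \<in> e}" if "e \<in> edges G" for e
    using assms(1) that by (auto simp: simple_graph_def)
  have "(\<Sum>e\<in>edges G. f e) \<le> (\<Sum>e\<in>edges G. \<Sum>x\<in>{x \<in> verts G. x \<in> e}. f e * c x)"
  proof (intro sum_mono)
    fix e
    assume e: "e \<in> edges G"
    have "f e * 1 \<le> f e * (\<Sum>x\<in>e. c x)"
      using assms(2,4) e by (intro mult_left_mono) (auto simp: fractional_matching_def)
    then show "f e \<le> (\<Sum>x\<in>{x \<in> verts G. x \<in> e}. f e * c x)"
      using sub[OF e] by (simp add: sum_distrib_left)
  qed
  also have "\<dots> = (\<Sum>x\<in>verts G. \<Sum>e\<in>{e \<in> edges G. x \<in> e}. f e * c x)"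
    by (rule sum.swap_restrict) (use fin in auto)
  also have "\<dots> = (\<Sum>x\<in>verts G. c x * (\<Sum>e\<in>{e \<in> edges G. x \<in> e}. f e))"
    by (simp add: sum_distrib_left mult.commute)
  also have "\<dots> \<le> (\<Sum>x\<in>verts G. c x * 1)"
    using assms(2,3) by (intro sum_mono mult_left_mono) (auto simp: fractional_matching_def)
  finally show ?thesis
    by simp
qed

text \<open>A matching of the bipartite double cover, with weight one half on each of its edges,
  projects to a fractional matching.\<close>

lemma fractional_matching_of_double_cover:
  assumes "simple_graph G" and M: "M \<subseteq> {(x, y). {x, y} \<in> edges G}"
    and "inj_on fst M" "inj_on snd M"
  shows "\<exists>f. fractional_matching G f \<and> (\<Sum>e\<in>edges G. f e) = card M / 2"
proof -
  \<comment> \<open>Both orientations of \<open>e\<close> are counted, so an edge gets weight 0, 1/2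
    or 1.\<close>
  define f where "f e = real (card {p \<in> M. {fst p, snd p} = e}) / 2" for e
  have fin: "finite (verts G)" "finite (edges G)"
    using assms(1) simple_graph_finite_edges by (auto simp: simple_graph_def)
  have sub: "e \<subseteq> verts G" "card e = 2" if "e \<in> edges G" for e
    using assms(1) that by (auto simp: simple_graph_def)
  have "M \<subseteq> verts G \<times> verts G"
    using M sub by fastforce
  then have finM: "finite M"
    using fin finite_subset by fastforce
  have tot: "(\<Sum>e\<in>F. f e) = card {p \<in> M. {fst p, snd p} \<in> F} / 2" if "finite F" for F
  proof -
    have "card {p \<in> M. {fst p, snd p} \<in> F} = card (\<Union>e\<in>F. {p \<in> M. {fst p, snd p} = e})"
      by (rule arg_cong[of _ _ card]) auto
    also have "\<dots> = (\<Sum>e\<in>F. card {p \<in> M. {fst p, snd p} = e})"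
      by (rule card_UN_disjoint) (use finM that in auto)
    finally show ?thesis
      by (simp add: f_def sum_divide_distrib)
  qed
  \<comment> \<open>Injectivity of the projections lets \<open>x\<close> occur at most once as a
    first and at most once as a second coordinate, each time with weight 1/2.\<close>
  have deg: "(\<Sum>e\<in>{e \<in> edges G. x \<in> e}. f e) \<le> 1" for x
  proof -
    have "{p \<in> M. {fst p, snd p} \<in> {e \<in> edges G. x \<in> e}}
        \<subseteq> {p \<in> M. fst p = x} \<union> {p \<in> M. snd p = x}"
      by auto
    then have "card {p \<in> M. {fst p, snd p} \<in> {e \<in> edges G. x \<in> e}}
        \<le> card ({p \<in> M. fst p = x} \<union> {p \<in> M. snd p = x})"
      using finM by (intro card_mono) auto
    also have "\<dots> \<le> card {p \<in> M. fst p = x} + card {p \<in> M. snd p = x}"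
      by (rule card_Un_le)
    also have "card {p \<in> M. fst p = x} \<le> 1"
      using assms(3) finM by (auto simp: card_le_Suc0_iff_eq inj_on_def)
    also have "card {p \<in> M. snd p = x} \<le> 1"
      using assms(4) finM by (auto simp: card_le_Suc0_iff_eq inj_on_def)
    finally show ?thesis
      using fin by (subst tot) auto
  qed
  have "f e \<le> 1" if e: "e \<in> edges G" for e
  proof -
    obtain x where "x \<in> e"
      using sub(2)[OF e] by fastforce
    then have "f e \<le> (\<Sum>e\<in>{e \<in> edges G. x \<in> e}. f e)"
      using e fin by (intro member_le_sum) (auto simp: f_def)
    then show ?thesis
      using deg[of x] by linarith
  qed
  then have "fractional_matching G f"
    using deg by (auto simp: fractional_matching_def f_def)
  moreover have "{p \<in> M. {fst p, snd p} \<in> edges G} = M"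
    using M by auto
  ultimately show ?thesis
    using tot[OF fin(2)] by auto
qed

text \<open>\<open>GREATEST\<close> is determined by an attained upper bound, hence both a witness
  and a bound are supplied.\<close>

lemma fractional_matching_number_eqI:
  assumes "fractional_matching G f" "(\<Sum>e\<in>edges G. f e) = w"
    and "\<And>f. fractional_matching G f \<Longrightarrow> (\<Sum>e\<in>edges G. f e) \<le> w"
  shows "fractional_matching_number G = w"
  unfolding fractional_matching_number_def
  by (rule Greatest_equality) (use assms in auto)

text \<open>With \<open>d\<close> the maximal deficiency of a vertex set in the double cover, Hall's
  theorem gives a fractional matching of weight at least \<open>(card V - d) / 2\<close>, and a set
  attaining \<open>d\<close> gives a fractional vertex cover of exactly this weight. By duality both
  are optimal.\<close>

lemma fractional_Tutte_Berge:
  assumes "simple_graph G"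
  obtains T I f where "T \<subseteq> verts G" "I \<subseteq> verts G" "T \<inter> I = {}"
    and "\<And>x y. x \<in> I \<Longrightarrow> {x, y} \<in> edges G \<Longrightarrow> y \<in> T"
    and "2 * fractional_matching_number G = real (card (verts G)) + real (card T) - real (card I)"
    and "fractional_matching G f" "(\<Sum>e\<in>edges G. f e) = fractional_matching_number G"
proof -
  define V where "V = verts G"
  define E where "E = {(x, y). {x, y} \<in> edges G}"
  have finV: "finite V"
    using assms by (auto simp: simple_graph_def V_def)
  have EV: "E \<subseteq> V \<times> V"
    using assms by (auto simp: simple_graph_def V_def E_def)
  have finE: "finite E"
    using EV finV finite_subset by fastforce
  define D where "D = (\<lambda>S. card S - card (E `` S)) ` Pow V"
  define d where "d = Max D"
  have D: "finite D" "D \<noteq> {}"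
    using finV by (auto simp: D_def)
  have Hall: "card S \<le> card (E `` S) + d" if "S \<subseteq> V" for S
  proof -
    have "card S - card (E `` S) \<le> d"
      unfolding d_def using D that by (intro Max_ge) (auto simp: D_def)
    then show ?thesis
      by linarith
  qed
  have "\<exists>S \<subseteq> V. card S = card (E `` S) + d"
  proof -
    have "d \<in> D"
      unfolding d_def using D by (rule Max_in)
    then obtain S where S: "S \<subseteq> V" "d = card S - card (E `` S)"
      by (auto simp: D_def)
    show ?thesis
    proof (cases "d = 0")
      case True
      then show ?thesis
        \<comment> \<open>Subtraction is truncated, so a set realising \<open>d = 0\<close> may have
          an image larger than itself; the empty set gives equality.\<close>
        by (intro exI[of _ "{}"]) auto
    next
      case False
      then show ?thesis
        using S by (intro exI[of _ S]) auto
    qed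
  qed
  then obtain S where S: "S \<subseteq> V" "card S = card (E `` S) + d"
    by blast
  \<comment> \<open>Discarding the common part of \<open>S\<close> and its image keeps the
    difference \<open>d\<close>. A neighbour in \<open>S\<close> of a vertex of \<open>I\<close>
    would, by symmetry of \<open>E\<close>, put that vertex into the image of \<open>S\<close>; so
    all neighbours of \<open>I\<close> lie in \<open>T\<close>.\<close>
  define T where "T = E `` S - S"
  define I where "I = S - E `` S"
  have sym: "(y, x) \<in> E" if "(x, y) \<in> E" for x y
    using that by (simp add: E_def insert_commute)
  have TI: "T \<subseteq> V" "I \<subseteq> V" "T \<inter> I = {}"
    using S(1) EV by (auto simp: T_def I_def)
  have nb: "y \<in> T" if "x \<in> I" "{x, y} \<in> edges G" for x y
    using that sym[of x y] by (auto simp: T_def I_def E_def)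
  have finTI: "finite T" "finite I" "finite S" "finite (E `` S)"
    using TI S(1) finV finite_subset finE by (auto simp: finite_Image)
  have cTI: "card I = card T + d"
  proof -
    have "card (E `` S) = card T + card (E `` S \<inter> S)"
      unfolding T_def using finTI by (subst card_Un_disjoint[symmetric]) (auto intro: arg_cong[of _ _ card])
    moreover have "card S = card I + card (E `` S \<inter> S)"
      unfolding I_def using finTI by (subst card_Un_disjoint[symmetric]) (auto intro: arg_cong[of _ _ card])
    ultimately show ?thesis
      using S(2) by linarith
  qed
  have "\<exists>M \<subseteq> E. inj_on fst M \<and> inj_on snd M \<and> card V \<le> card M + d"
    using deficiency_Hall[of V E d] finV finE EV Hall by blast
  then obtain M where M: "M \<subseteq> E" "inj_on fst M" "inj_on snd M" "card V \<le> card M + d"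
    by blast
  obtain f where f: "fractional_matching G f" "(\<Sum>e\<in>edges G. f e) = card M / 2"
    using fractional_matching_of_double_cover[OF assms, of M] M by (auto simp: E_def)
  \<comment> \<open>The half-integral dual solution: an edge with an end in \<open>I\<close> has its
    other end in \<open>T\<close>, and any other edge has weight at least 1/2 at both ends.\<close>
  define c :: "'a \<Rightarrow> real" where "c x = (if x \<in> T then 1 else if x \<in> I then 0 else 1 / 2)" for x
  have cover: "1 \<le> (\<Sum>x\<in>e. c x)" if e: "e \<in> edges G" for e
  proof -
    have "card e = 2"
      using e assms by (simp add: simple_graph_def)
    then obtain x y where xy: "e = {x, y}" "x \<noteq> y"
      by (meson card_2_iff)
    then show ?thesis
      using nb[of x y] nb[of y x] e TI(3) by (auto simp: c_def insert_commute)
  qed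
  have csum: "(\<Sum>x\<in>V. c x) = (real (card V) + real (card T) - real (card I)) / 2"
  proof -
    have "c x = 1 / 2 + (if x \<in> T then 1 / 2 else 0) - (if x \<in> I then 1 / 2 else 0)" for x
      using TI(3) by (auto simp: c_def)
    moreover have "V \<inter> T = T" "V \<inter> I = I"
      using TI by auto
    ultimately show ?thesis
      using finV by (simp add: sum.distrib sum_subtractf sum.If_cases add_divide_distrib diff_divide_distrib)
  qed
  have upper: "(\<Sum>e\<in>edges G. f e) \<le> (real (card V) + real (card T) - real (card I)) / 2"
    if "fractional_matching G f" for f
  proof -
    have "(\<Sum>e\<in>edges G. f e) \<le> (\<Sum>x\<in>verts G. c x)"
      by (rule fractional_matching_le_cover[OF assms that _ cover]) (simp_all add: c_def)
    then show ?thesis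
      using csum by (simp add: V_def)
  qed
  have eq: "(\<Sum>e\<in>edges G. f e) = (real (card V) + real (card T) - real (card I)) / 2"
    using upper[OF f(1)] f(2) M(4) cTI by simp
  have num: "fractional_matching_number G = (real (card V) + real (card T) - real (card I)) / 2"
    using fractional_matching_number_eqI[OF f(1) eq upper] .
  show ?thesis
    by (rule that[of T I f]) (use TI nb cTI num f(1) eq in \<open>auto simp: V_def\<close>)
qed

section \<open>Counting cliques\<close>

text \<open>A complete subgraph is determined by its vertex set, so vertex sets are counted.
  \<open>finite K\<close> excludes infinite sets, whose \<open>card\<close> is 0.\<close>

definition cliques :: "'a sgraph \<Rightarrow> nat \<Rightarrow> 'a set set" where
  "cliques G l = {K. K \<subseteq> verts G \<and> finite K \<and> card K = l \<and>
     (\<forall>x\<in>K. \<forall>y\<in>K. x \<noteq> y \<longrightarrow> {x, y} \<in> edges G)}"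

text \<open>A copy of the complete graph has every pair of its vertices as an edge, which makes
  \<open>verts\<close> a bijection from the copies to the cliques.\<close>

lemma subgraph_count_complete_graph:
  "subgraph_count (complete_graph l) G = card (cliques G l)"
proof -
  let ?A = "{S. subgraph S G \<and> graph_isomorphic (complete_graph l) S}"
  have A: "finite (verts S) \<and> card (verts S) = l \<and> edges S = {e. e \<subseteq> verts S \<and> card e = 2}"
    if S: "S \<in> ?A" for S
  proof -
    have simple: "simple_graph S"
      using S by (simp add: subgraph_def)
    obtain \<phi> where bij: "bij_betw \<phi> {..<l} (verts S)"
      and iso: "\<And>x y. x < l \<Longrightarrow> y < l \<Longrightarrow>
        ({x, y} \<subseteq> {..<l} \<and> card {x, y} = 2) \<longleftrightarrow> {\<phi> x, \<phi> y} \<in> edges S"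
      using S by (auto simp: graph_isomorphic_def complete_graph_def)
    have "e \<in> edges S" if e: "e \<subseteq> verts S" "card e = 2" for e
    proof -
      obtain a b where ab: "e = {a, b}" "a \<noteq> b"
        using e(2) by (meson card_2_iff)
      then have "a \<in> \<phi> ` {..<l}" "b \<in> \<phi> ` {..<l}"
        using e(1) bij by (auto simp: bij_betw_def)
      then obtain x y where "x < l" "y < l" "a = \<phi> x" "b = \<phi> y"
        by auto
      then show ?thesis
        using iso[of x y] ab by (cases "x = y") auto
    qed
    then have "edges S = {e. e \<subseteq> verts S \<and> card e = 2}"
      using simple by (auto simp: simple_graph_def)
    moreover have "card (verts S) = l"
      using bij_betw_same_card[OF bij] by simp
    ultimately show ?thesis
      using simple by (simp add: simple_graph_def)
  qed
  have "bij_betw verts ?A (cliques G l)"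
  proof (rule bij_betw_imageI)
    show "inj_on verts ?A"
    proof (rule inj_onI)
      fix S S'
      assume "S \<in> ?A" "S' \<in> ?A" "verts S = verts S'"
      then show "S = S'"
        using A[of S] A[of S'] by simp
    qed
    show "verts ` ?A = cliques G l"
    proof
      show "verts ` ?A \<subseteq> cliques G l"
      proof
        fix K
        assume "K \<in> verts ` ?A"
        then obtain S where S: "S \<in> ?A" "K = verts S"
          by blast
        have "verts S \<subseteq> verts G" "edges S \<subseteq> edges G"
          using S(1) by (auto simp: subgraph_def)
        moreover have "{x, y} \<in> edges S" if "x \<in> K" "y \<in> K" "x \<noteq> y" for x y
          using A[OF S(1)] S(2) that by auto
        ultimately show "K \<in> cliques G l"
          using A[OF S(1)] S(2) by (auto simp: cliques_def)
      qed
      show "cliques G l \<subseteq> verts ` ?A"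
      proof
        fix K
        assume K: "K \<in> cliques G l"
        define S where "S = \<lparr>verts = K, edges = {e. e \<subseteq> K \<and> card e = 2}\<rparr>"
        have "subgraph S G"
          using K by (auto simp: S_def subgraph_def simple_graph_def cliques_def card_2_iff)
        moreover have "graph_isomorphic (complete_graph l) S"
        proof -
          obtain \<phi> where bij: "bij_betw \<phi> {..<l} K"
            using K ex_bij_betw_nat_finite[of K] by (auto simp: cliques_def atLeast0LessThan)
          \<comment> \<open>The isomorphism condition also ranges over \<open>x = y\<close>, where
            both sides fail because a singleton does not have two elements.\<close>
          have "({x, y} \<subseteq> {..<l} \<and> card {x, y} = 2) \<longleftrightarrow> ({\<phi> x, \<phi> y} \<subseteq> K \<and> card {\<phi> x, \<phi> y} = 2)"
            if "x < l" "y < l" for x y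
            using that bij by (auto simp: bij_betw_def inj_on_def card_insert_if)
          then show ?thesis
            using bij unfolding graph_isomorphic_def by (auto simp: S_def complete_graph_def)
        qed
        ultimately show "K \<in> verts ` ?A"
          by (intro image_eqI[of _ _ S]) (auto simp: S_def)
      qed
    qed
  qed
  then show ?thesis
    unfolding subgraph_count_def by (rule bij_betw_same_card)
qed

lemma finite_cliques: "finite (verts G) \<Longrightarrow> finite (cliques G l)"
  by (rule finite_subset[of _ "Pow (verts G)"]) (auto simp: cliques_def)

text \<open>Serves to count cliques that consist of one vertex of \<open>J\<close> and
  \<open>r\<close> vertices of \<open>Q\<close>.\<close>

lemma card_inserts_subsets_le:
  assumes "finite J" "finite Q"
  shows "card ((\<lambda>(j, K). insert j K) ` (J \<times> {K. K \<subseteq> Q \<and> card K = r})) \<le> card J * (card Q choose r)"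
proof -
  have "finite {K. K \<subseteq> Q \<and> card K = r}"
    using assms by simp
  then show ?thesis
    using card_image_le[of "J \<times> {K. K \<subseteq> Q \<and> card K = r}" "\<lambda>(j, K). insert j K"]
      n_subsets[OF assms(2), of r] assms(1) by (simp add: card_cartesian_product)
qed

lemma card_inserts_subsets:
  assumes "finite J" "finite Q" "J \<inter> Q = {}"
  shows "card ((\<lambda>(j, K). insert j K) ` (J \<times> {K. K \<subseteq> Q \<and> card K = r})) = card J * (card Q choose r)"
proof -
  have "inj_on (\<lambda>(j, K). insert j K) (J \<times> {K. K \<subseteq> Q \<and> card K = r})"
  proof (rule inj_onI, clarsimp)
    fix j K j' K'
    assume *: "j \<in> J" "j' \<in> J" "K \<subseteq> Q" "K' \<subseteq> Q" "insert j K = insert j' K'"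
    have "insert j K \<inter> J = {j}" "insert j' K' \<inter> J = {j'}"
      using * assms(3) by auto
    moreover have "insert j K \<inter> Q = K" "insert j' K' \<inter> Q = K'"
      using * assms(3) by auto
    ultimately show "j = j' \<and> K = K'"
      using *(5) by (metis singleton_inject)
  qed
  then show ?thesis
    using n_subsets[OF assms(2), of r] by (simp add: card_image card_cartesian_product)
qed

section \<open>Upper bound for the cliques of a graph with a barrier\<close>

text \<open>The other \<open>r\<close> vertices of such a clique are neighbours of
  \<open>v\<close>.\<close>

lemma card_cliques_through_vertex:
  assumes "simple_graph G"
  shows "card {K \<in> cliques G (Suc r). v \<in> K} \<le> (vertex_degree G v choose r)"
proof -
  define N where "N = {y. {v, y} \<in> edges G}"
  have "N \<subseteq> verts G" "finite (verts G)"
    using assms by (auto simp: simple_graph_def N_def)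
  then have finN: "finite N"
    using finite_subset by blast
  have "{e \<in> edges G. v \<in> e} = (\<lambda>y. {v, y}) ` N"
  proof -
    have "e \<in> (\<lambda>y. {v, y}) ` N" if "e \<in> edges G" "v \<in> e" for e
    proof -
      have "card e = 2"
        using assms that by (simp add: simple_graph_def)
      then obtain a b where "e = {a, b}"
        by (meson card_2_iff)
      then show ?thesis
        using that by (auto simp: N_def insert_commute)
    qed
    then show ?thesis
      by (auto simp: N_def)
  qed
  moreover have "inj_on (\<lambda>y. {v, y}) N"
    by (auto simp: inj_on_def doubleton_eq_iff)
  ultimately have deg: "vertex_degree G v = card N"
    by (simp add: vertex_degree_def card_image)
  have "{K \<in> cliques G (Suc r). v \<in> K}
      \<subseteq> (\<lambda>(j, K). insert j K) ` ({v} \<times> {K. K \<subseteq> N \<and> card K = r})"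
  proof
    fix K
    assume K: "K \<in> {K \<in> cliques G (Suc r). v \<in> K}"
    then have "K = insert v (K - {v})" "K - {v} \<subseteq> N" "card (K - {v}) = r"
      by (auto simp: cliques_def N_def)
    then show "K \<in> (\<lambda>(j, K). insert j K) ` ({v} \<times> {K. K \<subseteq> N \<and> card K = r})"
      by (intro image_eqI[of _ _ "(v, K - {v})"]) auto
  qed
  then have "card {K \<in> cliques G (Suc r). v \<in> K}
      \<le> card ((\<lambda>(j, K). insert j K) ` ({v} \<times> {K. K \<subseteq> N \<and> card K = r}))"
    using finN by (intro card_mono) auto
  then show ?thesis
    using card_inserts_subsets_le[of "{v}" N r] finN deg by simp
qed

text \<open>A clique that contains some \<open>x\<close> in \<open>I\<close> has all its other
  vertices in \<open>T\<close>; the remaining cliques lie outside \<open>I\<close>.\<close>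

lemma card_cliques_avoiding_vertex:
  assumes "finite (verts G)" "I \<subseteq> verts G"
    and nb: "\<And>x y. x \<in> I \<Longrightarrow> {x, y} \<in> edges G \<Longrightarrow> y \<in> T" and "T \<inter> I = {}"
    and "T \<subseteq> verts G"
  shows "card {K \<in> cliques G (Suc r). v \<notin> K}
    \<le> (card (verts G - I - {v}) choose Suc r) + card (I - {v}) * (card (T - {v}) choose r)"
proof -
  let ?A = "{K. K \<subseteq> verts G - I - {v} \<and> card K = Suc r}"
  let ?B = "(\<lambda>(j, K). insert j K) ` ((I - {v}) \<times> {K. K \<subseteq> T - {v} \<and> card K = r})"
  have fin: "finite I" "finite T"
    using assms finite_subset by blast+
  have "{K \<in> cliques G (Suc r). v \<notin> K} \<subseteq> ?A \<union> ?B"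
  proof
    fix K
    assume K: "K \<in> {K \<in> cliques G (Suc r). v \<notin> K}"
    show "K \<in> ?A \<union> ?B"
    proof (cases "K \<inter> I = {}")
      case True
      then show ?thesis
        using K by (auto simp: cliques_def)
    next
      case False
      then obtain x where x: "x \<in> K" "x \<in> I"
        by blast
      then have "K = insert x (K - {x})" "K - {x} \<subseteq> T - {v}" "card (K - {x}) = r"
        using K nb[of x] by (auto simp: cliques_def)
      then have "K \<in> ?B"
        using x K by (intro image_eqI[of _ _ "(x, K - {x})"]) auto
      then show ?thesis
        by blast
    qed
  qed
  then have "card {K \<in> cliques G (Suc r). v \<notin> K} \<le> card (?A \<union> ?B)"
    using fin assms(1) by (intro card_mono) auto
  also have "\<dots> \<le> card ?A + card ?B"
    by (rule card_Un_le)
  also have "card ?A = (card (verts G - I - {v}) choose Suc r)"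
    using n_subsets[of "verts G - I - {v}" "Suc r"] assms(1) by simp
  also have "card ?B \<le> card (I - {v}) * (card (T - {v}) choose r)"
    using fin by (intro card_inserts_subsets_le) auto
  finally show ?thesis
    by simp
qed

text \<open>Cliques are split according to whether they contain \<open>v\<close>. The bound has the
  form of the clique count of the extremal graph, where the special vertex belongs to the
  independent part, but here \<open>v\<close> may lie anywhere.\<close>

lemma card_cliques_le:
  assumes G: "simple_graph G" "T \<subseteq> verts G" "I \<subseteq> verts G" "T \<inter> I = {}"
    and nb: "\<And>x y. x \<in> I \<Longrightarrow> {x, y} \<in> edges G \<Longrightarrow> y \<in> T"
    and "I \<noteq> {}" and v: "v \<in> verts G"
  shows "card (cliques G (Suc r)) \<le> (card (verts G - I) choose Suc r)
    + (card I - 1) * (card T choose r) + (vertex_degree G v choose r)"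
proof -
  have finV: "finite (verts G)"
    using G(1) by (simp add: simple_graph_def)
  then have fin: "finite I" "finite T"
    using G finite_subset by blast+
  obtain m where m: "card I = Suc m"
    using fin(1) \<open>I \<noteq> {}\<close> by (cases "card I") auto
  have "cliques G (Suc r) = {K \<in> cliques G (Suc r). v \<notin> K} \<union> {K \<in> cliques G (Suc r). v \<in> K}"
    by auto
  then have "card (cliques G (Suc r))
      \<le> card {K \<in> cliques G (Suc r). v \<notin> K} + card {K \<in> cliques G (Suc r). v \<in> K}"
    by (metis card_Un_le)
  also have "\<dots> \<le> card {K \<in> cliques G (Suc r). v \<notin> K} + (vertex_degree G v choose r)"
    using card_cliques_through_vertex[OF G(1)] by simp
  also have "card {K \<in> cliques G (Suc r). v \<notin> K}
      \<le> (card (verts G - I - {v}) choose Suc r) + card (I - {v}) * (card (T - {v}) choose r)"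
    by (rule card_cliques_avoiding_vertex) (use G nb finV in auto)
  also have "\<dots> \<le> (card (verts G - I) choose Suc r) + (card I - 1) * (card T choose r)"
  proof (cases "v \<in> I")
    case True
    then have "verts G - I - {v} = verts G - I" "T - {v} = T"
      using G by auto
    then show ?thesis
      using True fin by simp
  next
    case False
    \<comment> \<open>Moving one vertex of \<open>I\<close> to the place of \<open>v\<close> only creates cliques.\<close>
    define q where "q = card (verts G - I - {v})"
    have "v \<in> verts G - I"
      using False v by simp
    then have q: "card (verts G - I) = Suc q"
      unfolding q_def using finV by (metis card_Suc_Diff1 finite_Diff)
    have "T - {v} \<subseteq> verts G - I - {v}"
      using G by auto
    then have "card (T - {v}) \<le> q"
      unfolding q_def using finV by (intro card_mono) auto
    then have 1: "(card (T - {v}) choose r) \<le> (q choose r)"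
      by (rule binomial_right_mono)
    have "card (T - {v}) \<le> card T"
      using fin by (intro card_mono) auto
    then have 2: "m * (card (T - {v}) choose r) \<le> m * (card T choose r)"
      by (intro mult_le_mono binomial_right_mono) auto
    have "I - {v} = I"
      using False by auto
    \<comment> \<open>Of the \<open>Suc m\<close> terms for the vertices of \<open>I\<close>, one is
      absorbed by Pascal's rule for \<open>Suc q choose Suc r\<close> and the other \<open>m\<close>
      by fact \<open>2\<close>.\<close>
    then show ?thesis
      using add_mono[OF 1 2] m q by (simp add: q_def[symmetric])
  qed
  finally show ?thesis
    by simp
qed

section \<open>Lower bound for the cliques of the extremal graph\<close>

text \<open>Three disjoint families of cliques are exhibited: those inside the complete part
  \<open>P\<close>, those with one vertex of \<open>J\<close>, and those through \<open>u\<close>.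
  The main bound uses only this inequality.\<close>

lemma card_cliques_extremal_graph:
  fixes \<delta> n t :: nat and s :: real
  defines "a \<equiv> nat \<lfloor>2 * s - 2 * real t\<rfloor>" and "m \<equiv> nat \<lfloor>real n + real t - 2 * s\<rfloor>"
  assumes "\<delta> \<le> t" "m \<ge> 1"
  shows "(t + a choose Suc r) + (m - 1) * (t choose r) + (\<delta> choose r)
    \<le> card (cliques (extremal_graph \<delta> n s t) (Suc r))"
proof -
  let ?H = "extremal_graph \<delta> n s t"
  define P :: "(nat + nat + nat) set" where "P = Inl ` {..<t} \<union> (Inr \<circ> Inl) ` {..<a}"
  \<comment> \<open>Indices start at 1 because index 0 is the vertex \<open>u\<close>; this gives
    the factor \<open>m - 1\<close>.\<close>
  define J :: "(nat + nat + nat) set" where "J = (Inr \<circ> Inr) ` {1..<m}"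
  define u :: "nat + nat + nat" where "u = Inr (Inr 0)"
  let ?A = "{K. K \<subseteq> P \<and> card K = Suc r}"
  let ?B = "(\<lambda>(j, K). insert j K) ` (J \<times> {K. K \<subseteq> Inl ` {..<t} \<and> card K = r})"
  let ?C = "(\<lambda>(j, K). insert j K) ` ({u} \<times> {K. K \<subseteq> Inl ` {..<\<delta>} \<and> card K = r})"
  have verts: "verts ?H = P \<union> J \<union> {u}"
    using \<open>m \<ge> 1\<close>
    by (auto simp: extremal_graph_def delete_edges_def graph_join_def graph_union_def
        complete_graph_def edgeless_graph_def P_def J_def u_def a_def[symmetric] m_def[symmetric])
  have edges: "edges ?H = ((`) Inl ` {e. e \<subseteq> {..<t} \<and> card e = 2}
      \<union> (`) Inr ` (`) Inl ` {e. e \<subseteq> {..<a} \<and> card e = 2}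
      \<union> {{Inl x, Inr y} | x y. x < t \<and> y \<in> {..<a} <+> {..<m}})
      - {{Inl i, Inr (Inr 0)} | i. \<delta> \<le> i \<and> i < t}"
    by (simp add: extremal_graph_def delete_edges_def graph_join_def graph_union_def
        complete_graph_def edgeless_graph_def a_def m_def)
  have tt: "{Inl i, Inl j} \<in> edges ?H" if "i < t" "j < t" "i \<noteq> j" for i j
  proof -
    have "{i, j} \<in> {e. e \<subseteq> {..<t} \<and> card e = 2}"
      using that by simp
    then have "(Inl ` {i, j} :: (nat + nat + nat) set) \<in> (`) Inl ` {e. e \<subseteq> {..<t} \<and> card e = 2}"
      by (rule imageI)
    then show ?thesis
      unfolding edges by (simp add: doubleton_eq_iff)
  qed
  have aa: "{Inr (Inl i), Inr (Inl j)} \<in> edges ?H" if "i < a" "j < a" "i \<noteq> j" for i j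
  proof -
    have "{i, j} \<in> {e. e \<subseteq> {..<a} \<and> card e = 2}"
      using that by simp
    then have "(Inr ` Inl ` {i, j} :: (nat + nat + nat) set) \<in> (`) Inr ` (`) Inl ` {e. e \<subseteq> {..<a} \<and> card e = 2}"
      by (intro imageI)
    then show ?thesis
      unfolding edges by (simp add: doubleton_eq_iff)
  qed
  have ta: "{Inl i, Inr (Inl j)} \<in> edges ?H" if "i < t" "j < a" for i j
    unfolding edges using that by (auto simp: doubleton_eq_iff)
  \<comment> \<open>The last condition says exactly that the edge is not among the deleted ones at
    \<open>u\<close>.\<close>
  have tm: "{Inl i, Inr (Inr j)} \<in> edges ?H" if "i < t" "j < m" "j \<noteq> 0 \<or> i < \<delta>" for i j
    unfolding edges using that by (auto simp: doubleton_eq_iff)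
  have PP: "{x, y} \<in> edges ?H" if "x \<in> P" "y \<in> P" "x \<noteq> y" for x y
    using that tt aa ta by (auto simp: P_def insert_commute)
  have finP: "finite P" "finite J"
    by (auto simp: P_def J_def)
  have A: "?A \<subseteq> cliques ?H (Suc r)"
  proof
    fix K
    assume K: "K \<in> ?A"
    then have "finite K"
      using finP finite_subset by blast
    then show "K \<in> cliques ?H (Suc r)"
      unfolding cliques_def verts using K PP by blast
  qed
  have insert_clique: "insert j K \<in> cliques ?H (Suc r)"
    if j: "j \<in> verts ?H" "j \<notin> P" and K: "K \<subseteq> P" "card K = r"
      and nb: "\<And>x. x \<in> K \<Longrightarrow> {x, j} \<in> edges ?H" for j K
  proof -
    have "finite K"
      using K(1) finP finite_subset by blast
    moreover have "j \<notin> K"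
      using j K by blast
    moreover have "K \<subseteq> verts ?H"
      using K(1) verts by auto
    moreover have "{x, y} \<in> edges ?H" if "x \<in> K" "y \<in> K" "x \<noteq> y" for x y
      using PP that K(1) by blast
    ultimately show ?thesis
      using j(1) K(2) nb by (auto simp: cliques_def insert_commute)
  qed
  have B: "?B \<subseteq> cliques ?H (Suc r)"
  proof (rule image_subsetI, clarify)
    fix j and K :: "(nat + nat + nat) set"
    assume j: "j \<in> J" and K: "K \<subseteq> Inl ` {..<t}" "r = card K"
    have "{x, j} \<in> edges ?H" if "x \<in> K" for x
      using that j K(1) tm by (auto simp: J_def)
    moreover have "j \<in> verts ?H" "j \<notin> P" "K \<subseteq> P"
      using j K(1) by (auto simp: verts P_def J_def)
    ultimately show "insert j K \<in> cliques ?H (Suc (card K))"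
      using insert_clique[of j K] K(2) by simp
  qed
  have C: "?C \<subseteq> cliques ?H (Suc r)"
  proof (rule image_subsetI, clarify)
    fix K :: "(nat + nat + nat) set"
    assume K: "K \<subseteq> Inl ` {..<\<delta>}" "r = card K"
    have "{x, u} \<in> edges ?H" if "x \<in> K" for x
    proof -
      obtain i where "x = Inl i" "i < \<delta>"
        using \<open>x \<in> K\<close> K(1) by auto
      then show ?thesis
        using tm[of i 0] assms(3,4) by (simp add: u_def)
    qed
    moreover have "u \<in> verts ?H" "u \<notin> P" "K \<subseteq> P"
      using K(1) assms(3) by (auto simp: verts P_def u_def)
    ultimately show "insert u K \<in> cliques ?H (Suc (card K))"
      using insert_clique[of u K] K(2) by simp
  qed
  have "card P = t + a"
    unfolding P_def by (subst card_Un_disjoint) (auto simp: card_image inj_on_def)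
  then have cA: "card ?A = (t + a choose Suc r)"
    using n_subsets[OF finP(1), of "Suc r"] by simp
  have "card J = m - 1"
    unfolding J_def by (subst card_image) (auto simp: inj_on_def)
  then have cB: "card ?B = (m - 1) * (t choose r)"
    using finP by (subst card_inserts_subsets) (auto simp: J_def card_image)
  have cC: "card ?C = (\<delta> choose r)"
    by (subst card_inserts_subsets) (auto simp: u_def card_image)
  have JPu: "J \<inter> P = {}" "u \<notin> P" "u \<notin> J" "Inl ` {..<t} \<subseteq> P"
    by (auto simp: J_def P_def u_def)
  have inB: "K \<inter> J \<noteq> {} \<and> K \<subseteq> J \<union> P" if K: "K \<in> ?B" for K
  proof -
    obtain j L where "K = insert j L" "j \<in> J" "L \<subseteq> Inl ` {..<t}"
      using K by auto
    then show ?thesis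
      using JPu(4) by blast
  qed
  have inC: "u \<in> K" if "K \<in> ?C" for K
    using that by auto
  have disj: "?A \<inter> ?B = {}"
  proof (rule equals0I)
    fix K
    assume K: "K \<in> ?A \<inter> ?B"
    then have "K \<subseteq> P"
      by simp
    then show False
      using inB[OF IntD2[OF K]] JPu(1) by blast
  qed
  have disj': "(?A \<union> ?B) \<inter> ?C = {}"
  proof (rule equals0I)
    fix K
    assume K: "K \<in> (?A \<union> ?B) \<inter> ?C"
    from IntD1[OF K] have "K \<subseteq> J \<union> P"
    proof (rule UnE)
      assume "K \<in> ?A"
      then have "K \<subseteq> P"
        by simp
      then show ?thesis
        by (rule le_supI2)
    next
      assume "K \<in> ?B"
      from inB[OF this] show ?thesis
        by (rule conjunct2)
    qed
    then show False
      using inC[OF IntD2[OF K]] JPu(2,3) by auto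
  qed
  have fin: "finite (cliques ?H (Suc r))"
    using finP by (intro finite_cliques) (simp add: verts)
  note finABC = A[THEN finite_subset, OF fin] B[THEN finite_subset, OF fin] C[THEN finite_subset, OF fin]
  have "card ?A + card ?B + card ?C = card (?A \<union> ?B) + card ?C"
    by (simp only: card_Un_disjoint[OF finABC(1,2) disj])
  also have "\<dots> = card (?A \<union> ?B \<union> ?C)"
    by (rule card_Un_disjoint[OF finite_UnI[OF finABC(1,2)] finABC(3) disj', symmetric])
  also have "\<dots> \<le> card (cliques ?H (Suc r))"
    using fin by (rule card_mono) (intro Un_least A B C)
  finally show ?thesis
    unfolding cA cB cC .
qed

section \<open>Convexity in the size of the barrier\<close>

text \<open>By convexity a descent at one step forces a descent at every earlier step back to
  \<open>p\<close>. So going from \<open>t\<close> up to \<open>q\<close>, either the sequence never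
  drops or some value is already bounded by \<open>h p\<close>.\<close>

lemma convex_sequence_le_max:
  fixes h :: "nat \<Rightarrow> nat"
  assumes "\<And>i. p \<le> i \<Longrightarrow> i + 2 \<le> q \<Longrightarrow> 2 * h (i + 1) \<le> h i + h (i + 2)"
    and "p \<le> t" "t \<le> q"
  shows "h t \<le> max (h p) (h q)"
proof -
  have descent: "h i \<le> h p" if "p \<le> i" "i + 1 \<le> q" "h (i + 1) < h i" for i
    using that
  proof (induction i rule: dec_induct)
    case base
    then show ?case
      by simp
  next
    case (step i)
    have "2 * h (i + 1) \<le> h i + h (i + 2)"
      using step by (intro assms(1)) auto
    then show ?case
      using step by simp
  qed
  have "h t \<le> max (h p) (h k)" if "t \<le> k" "k \<le> q" for k
    using that
  proof (induction k rule: dec_induct)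
    case base
    then show ?case
      by simp
  next
    case (step k)
    then show ?case
      using descent[of k] \<open>p \<le> t\<close> by (cases "h (Suc k) < h k") auto
  qed
  then show ?thesis
    using \<open>t \<le> q\<close> by blast
qed

text \<open>By Pascal's rule the successive differences are again binomial coefficients, with lower
  index smaller by one, and these are monotone in \<open>k\<close>.\<close>

lemma binomial_convex: "2 * (k + 1 choose r) \<le> (k choose r) + (k + 2 choose r)"
proof (cases r)
  case (Suc q)
  have "(k choose q) \<le> (k + 1 choose q)"
    by (rule binomial_right_mono) simp
  then show ?thesis
    using Suc by simp
qed simp

text \<open>Reversing the index preserves convexity of the first summand. The second is a
  nonnegative increasing linear factor times a nondecreasing convex sequence.\<close>

lemma clique_bound_convex:
  fixes N k t r :: nat
  assumes "t + 2 \<le> k"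
  defines "h \<equiv> \<lambda>t. (k - t choose Suc r) + (N + t) * (t choose r)"
  shows "2 * h (t + 1) \<le> h t + h (t + 2)"
proof -
  obtain j where j: "k = t + 2 + j"
    using assms(1) le_Suc_ex by blast
  have 1: "2 * (j + 1 choose Suc r) \<le> (j choose Suc r) + (j + 2 choose Suc r)"
    by (rule binomial_convex)
  have "(N + t) * (2 * (t + 1 choose r)) \<le> (N + t) * ((t choose r) + (t + 2 choose r))"
    using binomial_convex by (intro mult_le_mono) auto
  moreover have "(t + 1 choose r) \<le> (t + 2 choose r)"
    by (rule binomial_right_mono) simp
  \<comment> \<open>With b(i) for \<open>i choose r\<close>, the second difference is
    \<open>N + t\<close> times that of b, plus twice b(t + 2) - b(t + 1).\<close>
  ultimately have 2: "2 * ((N + (t + 1)) * (t + 1 choose r))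
      \<le> (N + t) * (t choose r) + (N + (t + 2)) * (t + 2 choose r)"
    by (simp add: algebra_simps del: binomial_Suc_Suc)
  have "k - t = j + 2" "k - (t + 1) = j + 1" "k - (t + 2) = j"
    using j by auto
  then show ?thesis
    using 1 2 unfolding h_def by (simp del: binomial_Suc_Suc)
qed

text \<open>As \<open>2 * s\<close> is the integer \<open>k\<close>, the floors in the extremal
  graph are exact and its part sizes become natural numbers.\<close>

lemma clique_bound_le_extremal_clique_count:
  fixes k n \<delta> r t :: nat and s :: real
  assumes "real k = 2 * s" "k + 1 \<le> n" "\<delta> \<le> t" "2 * t \<le> k"
  shows "(k - t choose Suc r) + (n - k - 1 + t) * (t choose r) + (\<delta> choose r)
    \<le> extremal_clique_count \<delta> (Suc r) n s t"
proof -
  have "2 * s - 2 * real t = real_of_int (int (k - 2 * t))"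
    using assms by (simp add: of_nat_diff)
  then have a: "nat \<lfloor>2 * s - 2 * real t\<rfloor> = k - 2 * t"
    by (metis floor_of_int nat_int)
  have "real n + real t - 2 * s = real_of_int (int (n + t - k))"
    using assms by (simp add: of_nat_diff)
  then have m: "nat \<lfloor>real n + real t - 2 * s\<rfloor> = n + t - k"
    by (metis floor_of_int nat_int)
  have "t + (k - 2 * t) = k - t" "n + t - k - 1 = n - k - 1 + t"
    using assms by auto
  then show ?thesis
    using card_cliques_extremal_graph[of \<delta> t n s r] assms(2,3)
    unfolding a m extremal_clique_count_def subgraph_count_complete_graph by simp
qed

theorem theorem1p6:
  fixes G :: "'a sgraph"
    and n two_s \<delta> l :: nat
    and s :: real
  assumes two_s: "real two_s = 2 * s"
    and n_ge: "n \<ge> two_s + 1"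
    and s_ge: "two_s + 1 \<ge> 5"
    and \<delta>_pos: "\<delta> \<ge> 1"
    and l_ge: "l \<ge> 2"
    and graph: "simple_graph G"
    and order: "card (verts G) = n"
    and matching_number: "fractional_matching_number G = s"
    and min_deg: "min_degree G = \<delta>"
  shows "(even two_s \<longrightarrow>
            subgraph_count (complete_graph l) G
              \<le> max (extremal_clique_count \<delta> l n s \<delta>)
                    (extremal_clique_count \<delta> l n s (nat \<lfloor>s\<rfloor>))) \<and>
         (odd two_s \<longrightarrow>
            subgraph_count (complete_graph l) G
              \<le> max (extremal_clique_count \<delta> l n s \<delta>)
                    (extremal_clique_count \<delta> l n s (nat \<lfloor>s - 3 / 2\<rfloor>)))"
proof -
  obtain r where r: "l = Suc r"
    using l_ge by (cases l) auto
  obtain T I f where TI: "T \<subseteq> verts G" "I \<subseteq> verts G" "T \<inter> I = {}"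
    and nb: "\<And>x y. x \<in> I \<Longrightarrow> {x, y} \<in> edges G \<Longrightarrow> y \<in> T"
    and num: "2 * s = real n + real (card T) - real (card I)"
    and f: "fractional_matching G f" "(\<Sum>e\<in>edges G. f e) = s"
    using fractional_Tutte_Berge[OF graph] matching_number order by metis
  define t where "t = card T"
  have finV: "finite (verts G)"
    using graph by (simp add: simple_graph_def)
  then have fin: "finite T" "finite I"
    using TI finite_subset by blast+
  have cI: "card I + two_s = n + t"
    using num two_s by (simp add: t_def)
  have "I \<noteq> {}"
    using cI n_ge by auto
  have "card (T \<union> I) \<le> n"
    unfolding order[symmetric] using finV TI by (intro card_mono) auto
  \<comment> \<open>\<open>T\<close> and \<open>I\<close> are disjoint, so
    \<open>t + (n + t - two_s)\<close> is at most \<open>n\<close>.\<close>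
  then have t_le: "2 * t \<le> two_s"
    using cI card_Un_disjoint[OF fin TI(3)] by (simp add: t_def)
  have cVI: "card (verts G - I) = two_s - t"
    using cI card_Diff_subset[OF fin(2) TI(2)] order by simp
  have "verts G \<noteq> {}"
    using \<open>I \<noteq> {}\<close> TI by auto
  then have "\<delta> \<in> vertex_degree G ` verts G"
    unfolding min_deg[symmetric] min_degree_def using finV by (intro Min_in) auto
  then obtain v where v: "v \<in> verts G" "vertex_degree G v = \<delta>"
    by blast
  \<comment> \<open>All neighbours of a vertex of \<open>I\<close> lie in \<open>T\<close>, so its
    degree is at most \<open>t\<close>.\<close>
  have \<delta>_le: "\<delta> \<le> t"
  proof -
    obtain x where x: "x \<in> I"
      using \<open>I \<noteq> {}\<close> by blast
    have "\<delta> \<le> vertex_degree G x"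
      unfolding min_deg[symmetric] min_degree_def using finV x TI by (intro Min_le) auto
    also have "vertex_degree G x \<le> card ((\<lambda>y. {x, y}) ` T)"
      unfolding vertex_degree_def
    proof (rule card_mono)
      show "{e \<in> edges G. x \<in> e} \<subseteq> (\<lambda>y. {x, y}) ` T"
      proof
        fix e
        assume e: "e \<in> {e \<in> edges G. x \<in> e}"
        then have "card e = 2"
          using graph by (simp add: simple_graph_def)
        then obtain a b where "e = {a, b}"
          by (meson card_2_iff)
        then obtain y where "e = {x, y}"
          using e by (auto simp: insert_commute)
        then show "e \<in> (\<lambda>y. {x, y}) ` T"
          using nb[OF x] e by auto
      qed
    qed (use fin in auto)
    also have "\<dots> \<le> t"
      unfolding t_def using fin(1) by (rule card_image_le)
    finally show ?thesis .
  qed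
  \<comment> \<open>Otherwise a single vertex remains outside \<open>T\<close> and \<open>I\<close>.
    It spans no edge, so \<open>T\<close> covers all edges and duality gives
    \<open>s \<le> t\<close>, contrary to \<open>s = t + 1/2\<close>.\<close>
  have not_one: "two_s \<noteq> 2 * t + 1"
  proof
    assume *: "two_s = 2 * t + 1"
    have "T \<subseteq> verts G - I"
      using TI by auto
    then have "card (verts G - I - T) = 1"
      using cVI card_Diff_subset[OF fin(1), of "verts G - I"] * by (simp add: t_def)
    then obtain w where w: "verts G - I - T = {w}"
      by (auto simp: card_1_singleton_iff)
    have "1 \<le> (\<Sum>x\<in>e. if x \<in> T then 1 else 0 :: real)" if e: "e \<in> edges G" for e
    proof -
      have e2: "card e = 2" "e \<subseteq> verts G"
        using e graph by (auto simp: simple_graph_def)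
      then obtain x y where xy: "e = {x, y}" "x \<noteq> y"
        by (meson card_2_iff)
      have "{x, y} \<in> edges G" "{y, x} \<in> edges G" "x \<in> verts G" "y \<in> verts G"
        using xy e e2 by (auto simp: insert_commute)
      then have "x \<in> verts G - I - T \<and> y \<in> verts G - I - T" if "\<not> (x \<in> T \<or> y \<in> T)"
        using nb[of x y] nb[of y x] that by blast
      then have "x \<in> T \<or> y \<in> T"
        unfolding w using xy(2) by blast
      then show ?thesis
        using xy by auto
    qed
    then have "s \<le> (\<Sum>x\<in>verts G. if x \<in> T then 1 else 0)"
      using fractional_matching_le_cover[OF graph f(1), of "\<lambda>x. if x \<in> T then 1 else 0"] f(2) by simp
    also have "\<dots> = real t"
      using finV TI by (simp add: sum.If_cases t_def Int_absorb1)
    finally show False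
      using two_s * by simp
  qed
  \<comment> \<open>The summand \<open>\<delta> choose r\<close> is constant in \<open>i\<close> and
    is added back after the convexity argument.\<close>
  define h where "h i = (two_s - i choose Suc r) + (n - two_s - 1 + i) * (i choose r)" for i
  have "card I - 1 = n - two_s - 1 + t"
    using cI n_ge by simp
  then have count: "subgraph_count (complete_graph l) G \<le> h t + (\<delta> choose r)"
    using card_cliques_le[OF graph TI nb \<open>I \<noteq> {}\<close> v(1), where r = r] cVI v(2)
    by (simp add: subgraph_count_complete_graph r h_def t_def)
  \<comment> \<open>Here \<open>q\<close> is the upper end of the range of \<open>t\<close>; it
    depends on the parity of \<open>two_s\<close>.\<close>
  have main: "subgraph_count (complete_graph l) G
      \<le> max (extremal_clique_count \<delta> l n s \<delta>) (extremal_clique_count \<delta> l n s q)"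
    if q: "t \<le> q" "2 * q \<le> two_s" for q
  proof -
    have "h t \<le> max (h \<delta>) (h q)"
    proof (rule convex_sequence_le_max[where h = h])
      show "2 * h (i + 1) \<le> h i + h (i + 2)" if "\<delta> \<le> i" "i + 2 \<le> q" for i
        unfolding h_def using that q by (intro clique_bound_convex) simp
    qed (use \<delta>_le q in auto)
    moreover have "h i + (\<delta> choose r) \<le> extremal_clique_count \<delta> l n s i"
      if "\<delta> \<le> i" "2 * i \<le> two_s" for i
      unfolding h_def r using two_s n_ge that
      by (intro clique_bound_le_extremal_clique_count) auto
    note this[of \<delta>] this[of q]
    ultimately show ?thesis
      using count \<delta>_le q by linarith
  qed
  have "subgraph_count (complete_graph l) G
      \<le> max (extremal_clique_count \<delta> l n s \<delta>) (extremal_clique_count \<delta> l n s (nat \<lfloor>s\<rfloor>))"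
    if "even two_s"
  proof -
    obtain k where k: "two_s = 2 * k"
      using \<open>even two_s\<close> by (rule evenE)
    then have "s = real k"
      using two_s by simp
    then show ?thesis
      using main[of k] k t_le by simp
  qed
  moreover have "subgraph_count (complete_graph l) G
      \<le> max (extremal_clique_count \<delta> l n s \<delta>) (extremal_clique_count \<delta> l n s (nat \<lfloor>s - 3 / 2\<rfloor>))"
    if "odd two_s"
  proof -
    obtain k where k: "two_s = 2 * k + 1"
      using \<open>odd two_s\<close> by (rule oddE)
    then obtain j where j: "k = Suc j"
      using s_ge by (cases k) auto
    then have "s - 3 / 2 = real j"
      using two_s k by simp
    \<comment> \<open>For odd \<open>two_s\<close> the bound \<open>t_le\<close> gives
      \<open>t \<le> k\<close>, and \<open>not_one\<close> excludes \<open>t = k\<close>, which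
      leaves \<open>j = k - 1\<close> as the upper end.\<close>
    moreover have "t \<le> j"
      using k j t_le not_one by presburger
    ultimately show ?thesis
      using main[of j] k j by simp
  qed
  ultimately show ?thesis
    by blast
qed

end
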